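(* Let $\mathcal{G}=(S,(S_E,S_A),A,\mathrm{BM})$ be a two-player BM game with finite state set $S$, equipped with a parity objective given by a priority function $\chi:S\to\mathbb{N}$. Then $\mathcal{G}$ is positionally determined: for every state $s\in S$, either Eve and Banach win strategically from $s$ with a positional strategy for Eve, or Adam and Mazur win strategically from $s$ with a positional strategy for Adam. That is, for every $s$, either there is a positional strategy $\sigma$ of Eve such that for every (arbitrary) strategy $\tau$ of Adam Banach wins the Banach-Mazur game on the residual tree $\mathcal{G}(\sigma,\tau)$ from $s$, or there is a positional strategy $\tau$ of Adam such that for every (arbitrary) strategy $\sigma$ of Eve Mazur wins the Banach-Mazur game on the residual tree $\mathcal{G}(\sigma,\tau)$ from $s$.
   Context: **Two-player BM game.** A tuple $(S,(S_E,S_A),A,\mathrm{BM})$: $S$ is a finite set of states, partitioned into $S_E$ (Eve's states) and $S_A$ (Adam's states); $A$ is a finite nonempty set of actions; $\mathrm{BM}\subseteq S\times A\times S$ is such that for all $s\in S$, $a\in A$ there is some $s'$ with $(s,a,s')\in \mathrm{BM}$. **Strategies.** A strategy for Eve is a function $\sigma:(SA)^*S_E\to A$; a strategy for Adam is a function $\tau:(SA)^*S_A\to A$. A strategy is positional if its value depends only on the last state of the history. **Parity objective.** For $\chi:S\to\mathbb{N}$, $\mathrm{Par}=\{s_0s_1s_2\cdots\in S^\omega \mid \limsup_n \chi(s_n)\text{ is even}\}$. **Residual tree.** For strategies $\sigma,\tau$ and initial state $s$, let $\mathcal{G}_f(\sigma,\tau)\subseteq S(AS)^*$ be the smallest set containing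 $s$ and such that, if $wt\in \mathcal{G}_f(\sigma,\tau)$ with $t\in S$ its last letter, and $a=\sigma(wt)$ if $t\in S_E$, $a=\tau(wt)$ if $t\in S_A$, then $wtat'\in\mathcal{G}_f(\sigma,\tau)$ for all $t'$ with $(t,a,t')\in\mathrm{BM}$. The residual tree $\mathcal{G}(\sigma,\tau)$ is the set of infinite words all of whose prefixes in $S(AS)^*$ belong to $\mathcal{G}_f(\sigma,\tau)$. **Banach-Mazur game.** For a set $X$ of infinite words and an objective $\Phi$, the Banach-Mazur game on $X$ is played by Banach and Mazur: Mazur plays a finite prefix $w_0$ of some word of $X$; Banach extends it to a strictly longer finite prefix $w_1$ of some word of $X$; Mazur extends $w_1$ strictly to $w_2$, and so on alternately. Banach wins the play if the limit infinite word belongs to the objective; otherwise Mazur wins. "Banach (Mazur) wins the game" means that he has a winning strategy. On a residual tree with the parity objective, an infinite word is in the objective when its projection to $S^\omega$ (erasing the actions) is in $\mathrm{Par}$. **Strategic winning.** Eve and Banach win strategically from $s$ if there is a strategy $\sigma$ of Eve such that for every strategy $\tau$ of Adam, Banach wins the Banach-Mazur game on $\mathcal{G}(\sigma,\tau)$ from $s$. Adam and Mazur win strategically from $s$ if there is a strategy $\tau$ of Adam such that for every strategy $\sigma$ of Eve, Mazur wins the Banach-Mazur game on $\mathcal{G}(\sigma,\tau)$ from $s$. *)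

theory Defs
  imports "HOL-Library.Stream" "HOL-Library.Sublist" "HOL-Library.FuncSet"
    "HOL-Library.Extended_Nat" "HOL-Library.Liminf_Limsup"
begin

record ('s, 'a) game =
  states :: "'s set"
  eve :: "'s set"
  adam :: "'s set"
  actions :: "'a set"
  trans_rel :: "('s \<times> 'a \<times> 's) set"

definition bm_game :: "('s, 'a) game \<Rightarrow> bool" where
  "bm_game G \<longleftrightarrow>
     finite (states G) \<and>
     eve G \<union> adam G = states G \<and> eve G \<inter> adam G = {} \<and>
     finite (actions G) \<and> actions G \<noteq> {} \<and>
     trans_rel G \<subseteq> states G \<times> actions G \<times> states G \<and>
     (\<forall>s\<in>states G. \<forall>a\<in>actions G. \<exists>s'. (s, a, s') \<in> trans_rel G)"


text \<open>Words over the disjoint union of states and actions have letters of type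
  \<^typ>\<open>'s + 'a\<close>. The set \<open>histories G T\<close> is \<open>(SA)\<^sup>*T\<close>.\<close>

definition histories :: "('s, 'a) game \<Rightarrow> 's set \<Rightarrow> ('s + 'a) list set" where
  "histories G T =
     {concat (map (\<lambda>(s, a). [Inl s, Inr a]) ps) @ [Inl t] | ps t.
        set ps \<subseteq> states G \<times> actions G \<and> t \<in> T}"

text \<open>For a player owning the states \<open>T\<close>. Values outside \<open>histories G T\<close> are
  unconstrained and never used.\<close>

definition strategies :: "('s, 'a) game \<Rightarrow> 's set \<Rightarrow> (('s + 'a) list \<Rightarrow> 'a) set" where
  "strategies G T = histories G T \<rightarrow> actions G"

definition positional :: "('s, 'a) game \<Rightarrow> 's set \<Rightarrow> (('s + 'a) list \<Rightarrow> 'a) \<Rightarrow> bool" where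
  "positional G T f \<longleftrightarrow>
     (\<forall>h\<in>histories G T. \<forall>h'\<in>histories G T. last h = last h' \<longrightarrow> f h = f h')"


inductive_set finite_tree ::
  "('s, 'a) game \<Rightarrow> (('s + 'a) list \<Rightarrow> 'a) \<Rightarrow> (('s + 'a) list \<Rightarrow> 'a) \<Rightarrow> 's \<Rightarrow> ('s + 'a) list set"
  for G \<sigma> \<tau> s where
  root: "[Inl s] \<in> finite_tree G \<sigma> \<tau> s"
| step: "w @ [Inl t] \<in> finite_tree G \<sigma> \<tau> s \<Longrightarrow>
         a = (if t \<in> eve G then \<sigma> (w @ [Inl t]) else \<tau> (w @ [Inl t])) \<Longrightarrow>
         (t, a, t') \<in> trans_rel G \<Longrightarrow>
         w @ [Inl t, Inr a, Inl t'] \<in> finite_tree G \<sigma> \<tau> s"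

text \<open>In a word of \<open>S(AS)\<^sup>\<omega>\<close>, the prefixes lying in \<open>S(AS)\<^sup>*\<close> are those of
  odd length. Conversely, membership of all of these in \<^const>\<open>finite_tree\<close> forces the
  word to alternate between states and actions.\<close>

definition residual_tree ::
  "('s, 'a) game \<Rightarrow> (('s + 'a) list \<Rightarrow> 'a) \<Rightarrow> (('s + 'a) list \<Rightarrow> 'a) \<Rightarrow> 's \<Rightarrow> ('s + 'a) stream set"
  where
  "residual_tree G \<sigma> \<tau> s = {w. \<forall>n. stake (2 * n + 1) w \<in> finite_tree G \<sigma> \<tau> s}"


text \<open>The upper limit is taken in \<^typ>\<open>enat\<close>, since \<^typ>\<open>nat\<close> is not a complete lattice.\<close>

definition parity :: "'s set \<Rightarrow> ('s \<Rightarrow> nat) \<Rightarrow> 's stream set" where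
  "parity S \<chi> =
     {u \<in> streams S. \<exists>k. even k \<and> limsup (\<lambda>n. enat (\<chi> (u !! n))) = enat k}"

text \<open>The operation \<^term>\<open>sfilter isl\<close> erases the actions from an infinite word.\<close>

definition parity_objective :: "('s, 'a) game \<Rightarrow> ('s \<Rightarrow> nat) \<Rightarrow> ('s + 'a) stream set" where
  "parity_objective G \<chi> = {w. smap projl (sfilter isl w) \<in> parity (states G) \<chi>}"


text \<open>Banach-Mazur games on a set \<open>X\<close> of infinite words. A position is the list
  \<open>[w\<^sub>0, \<dots>, w\<^sub>n]\<close> of the moves made so far; Mazur moves at positions of even length and
  Banach at positions of odd length.\<close>

definition prefixes_of :: "'b stream set \<Rightarrow> 'b list set" where
  "prefixes_of X = {stake n w | n w. w \<in> X}"

definition bm_position :: "'b stream set \<Rightarrow> 'b list list \<Rightarrow> bool" where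
  "bm_position X ws \<longleftrightarrow> set ws \<subseteq> prefixes_of X \<and> successively strict_prefix ws"

definition bm_play :: "'b stream set \<Rightarrow> (nat \<Rightarrow> 'b list) \<Rightarrow> bool" where
  "bm_play X p \<longleftrightarrow> (\<forall>n. bm_position X (map p [0..<n]))"

text \<open>Unique for every play, as the moves get strictly longer.\<close>

definition bm_limit :: "(nat \<Rightarrow> 'b list) \<Rightarrow> 'b stream" where
  "bm_limit p = (THE w. \<forall>n. \<exists>k. p n = stake k w)"

definition banach_strategy :: "'b stream set \<Rightarrow> ('b list list \<Rightarrow> 'b list) \<Rightarrow> bool" where
  "banach_strategy X f \<longleftrightarrow>
     (\<forall>ws. bm_position X ws \<and> odd (length ws) \<longrightarrow> bm_position X (ws @ [f ws]))"

definition mazur_strategy :: "'b stream set \<Rightarrow> ('b list list \<Rightarrow> 'b list) \<Rightarrow> bool" where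
  "mazur_strategy X f \<longleftrightarrow>
     (\<forall>ws. bm_position X ws \<and> even (length ws) \<longrightarrow> bm_position X (ws @ [f ws]))"

definition banach_wins :: "'b stream set \<Rightarrow> 'b stream set \<Rightarrow> bool" where
  "banach_wins X \<Phi> \<longleftrightarrow>
     (\<exists>f. banach_strategy X f \<and>
       (\<forall>p. bm_play X p \<and> (\<forall>n. odd n \<longrightarrow> p n = f (map p [0..<n])) \<longrightarrow> bm_limit p \<in> \<Phi>))"

definition mazur_wins :: "'b stream set \<Rightarrow> 'b stream set \<Rightarrow> bool" where
  "mazur_wins X \<Phi> \<longleftrightarrow>
     (\<exists>f. mazur_strategy X f \<and>
       (\<forall>p. bm_play X p \<and> (\<forall>n. even n \<longrightarrow> p n = f (map p [0..<n])) \<longrightarrow> bm_limit p \<notin> \<Phi>))"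


definition eve_banach_win_with ::
  "('s, 'a) game \<Rightarrow> ('s \<Rightarrow> nat) \<Rightarrow> 's \<Rightarrow> (('s + 'a) list \<Rightarrow> 'a) \<Rightarrow> bool" where
  "eve_banach_win_with G \<chi> s \<sigma> \<longleftrightarrow>
     (\<forall>\<tau>\<in>strategies G (adam G). banach_wins (residual_tree G \<sigma> \<tau> s) (parity_objective G \<chi>))"

definition adam_mazur_win_with ::
  "('s, 'a) game \<Rightarrow> ('s \<Rightarrow> nat) \<Rightarrow> 's \<Rightarrow> (('s + 'a) list \<Rightarrow> 'a) \<Rightarrow> bool" where
  "adam_mazur_win_with G \<chi> s \<tau> \<longleftrightarrow>
     (\<forall>\<sigma>\<in>strategies G (eve G). mazur_wins (residual_tree G \<sigma> \<tau> s) (parity_objective G \<chi>))"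

end

theory Submission imports Defs begin

text \<open>A history is settled if some priority bounds all priorities below it and recurs below each
  of its descendants; Banach (Mazur) then wins below it when this priority is even (odd). A player
  wins densely on a set \<open>X\<close> of states if positional choices force every history to have a settled
  extension of the player's parity, as long as the play stays in \<open>X\<close>. The key dichotomy, by
  induction on \<open>X\<close> and for both players at once: either the player wins densely on all of \<open>X\<close>, or
  the opponent wins densely on a nonempty subset that the player cannot leave. One removes, for
  the owner of the top priority, the states from which that priority can be reached, and for the
  other player the states from which a region already won can be reached. Peeling off Adam's
  regions together with the states from which he can reach them leaves a set where Eve wins
  densely and which Adam cannot leave; on all other states Adam can reach a settled history of
  odd priority, which is what Mazur needs, as he moves first.\<close>

section \<open>Maximal sets, chains of words and upper limits\<close>

lemma maximal_set_exists:
  assumes "finite X" "P A" "\<And>B. P B \<Longrightarrow> B \<subseteq> X"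
  shows "\<exists>B. P B \<and> A \<subseteq> B \<and> (\<forall>C. P C \<longrightarrow> B \<subseteq> C \<longrightarrow> C = B)"
proof -
  have "finite {B. P B}" using assms(1,3) by (auto intro: finite_subset[of _ "Pow X"])
  from finite_has_maximal2[OF this, of A] assms(2) show ?thesis by auto
qed

lemma strict_chain_prefix:
  assumes "\<And>n. strict_prefix (p n) (p (Suc n))" "m \<le> n"
  shows "prefix (p m) (p n)"
  using assms(2)
proof (induction n rule: dec_induct)
  case (step n)
  then show ?case using assms(1)[of n] by (meson prefix_order.dual_order.trans prefix_order.less_imp_le)
qed simp

lemma strict_chain_length:
  assumes "\<And>n. strict_prefix (p n) (p (Suc n))"
  shows "n \<le> length (p n)"
proof (induction n)
  case (Suc n)
  then show ?case using prefix_length_less[OF assms[of n]] by simp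
qed simp

lemma prefix_nth:
  assumes "prefix x y" "i < length x"
  shows "x ! i = y ! i"
  using assms by (auto simp: prefix_def nth_append)

lemma strict_chain_limit:
  assumes chain: "\<And>n. strict_prefix (p n) (p (Suc n))"
  shows "\<exists>w. \<forall>n. p n = stake (length (p n)) w"
proof (intro exI allI)
  fix n
  \<comment> \<open>Letter \<open>i\<close> is read off \<open>p (Suc i)\<close>, the first word of
    the chain guaranteed to have a position \<open>i\<close>; all words that are long enough agree
    there.\<close>
  let ?w = "smap (\<lambda>i. p (Suc i) ! i) nats"
  show "p n = stake (length (p n)) ?w"
  proof (rule nth_equalityI)
    fix i assume i: "i < length (p n)"
    have "p n ! i = p (Suc i) ! i"
    proof (cases "n \<le> Suc i")
      case True
      then show ?thesis using i prefix_nth strict_chain_prefix[of p, OF chain] by metis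
    next
      case False
      have "i < length (p (Suc i))" using strict_chain_length[of p "Suc i", OF chain] by simp
      then show ?thesis using False prefix_nth strict_chain_prefix[of p "Suc i" n, OF chain] by fastforce
    qed
    then show "p n ! i = stake (length (p n)) ?w ! i" using i by simp
  qed simp
qed

lemma take_stake_le: "k \<le> n \<Longrightarrow> take k (stake n w) = stake k w"
  by (simp add: take_stake min_def)

lemma sfilter_alternating:
  assumes "\<And>k. isl (w !! (2 * k))" "\<And>k. \<not> isl (w !! (2 * k + 1))"
  shows "sfilter isl w !! k = w !! (2 * k)"
  using assms
proof (induction k arbitrary: w)
  case 0
  then have "isl (shd w)" using "0"(1)[of 0] by simp
  then have "sfilter isl (shd w ## stl w) = shd w ## sfilter isl (stl w)"
    by (simp only: sfilter_Stream if_True)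
  then show ?case by simp
next
  case (Suc k)
  have 1: "isl (shd w)" using Suc.prems(1)[of 0] by simp
  have 2: "\<not> isl (shd (stl w))" using Suc.prems(2)[of 0] by simp
  have "sfilter isl (shd w ## shd (stl w) ## stl (stl w)) = shd w ## sfilter isl (stl (stl w))"
    using 1 2 by (simp only: sfilter_Stream if_True if_False)
  then have "sfilter isl w !! Suc k = sfilter isl (stl (stl w)) !! k" by simp
  also have "\<dots> = stl (stl w) !! (2 * k)"
    using Suc.prems(1)[of "Suc _"] Suc.prems(2)[of "Suc _"] by (intro Suc.IH) simp_all
  finally show ?case by simp
qed

lemma limsup_enat_eqI:
  assumes "\<And>k. k0 \<le> k \<Longrightarrow> c k \<le> m" "\<And>n. \<exists>k\<ge>n. c k = m"
  shows "limsup (\<lambda>k. enat (c k)) = enat m"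
proof (rule antisym)
  show "limsup (\<lambda>k. enat (c k)) \<le> enat m"
    by (rule Limsup_bounded) (use assms(1) in \<open>auto simp: eventually_sequentially\<close>)
  show "enat m \<le> limsup (\<lambda>k. enat (c k))"
    unfolding limsup_INF_SUP
  proof (rule INF_greatest)
    fix n
    obtain k where "k \<ge> n" "c k = m" using assms(2) by blast
    then show "enat m \<le> (SUP k\<in>{n..}. enat (c k))" by (intro SUP_upper2[of k]) auto
  qed
qed

definition label :: "('s + 'a) list \<Rightarrow> 's" where
  "label u = projl (last u)"

lemma label_simps [simp]: "label [Inl s] = s" "label (w @ [Inl t]) = t" "label (w @ [x, Inl t]) = t"
  by (simp_all add: label_def)

section \<open>Safe actions, settled histories and winning on sets of states\<close>

locale priority_game =
  fixes G :: "('s, 'a) game" and \<chi> :: "'s \<Rightarrow> nat"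
  assumes game: "bm_game G"
begin

text \<open>Players are Booleans: \<^term>\<open>True\<close> stands for Eve and for even priorities,
  \<^term>\<open>False\<close> for Adam and for odd priorities.\<close>

definition own :: "bool \<Rightarrow> 's set" where
  "own e = (if e then eve G else adam G)"

text \<open>Successors are picked by Banach and Mazur, not by Eve or Adam. Cutting the game down to
  \<open>X\<close> therefore removes whole actions, never single successors.\<close>

definition enabled :: "'s set \<Rightarrow> 's \<Rightarrow> 'a set" where
  "enabled X s = {a \<in> actions G. \<forall>t. (s, a, t) \<in> trans_rel G \<longrightarrow> t \<in> X}"

definition arena :: "'s set \<Rightarrow> bool" where
  "arena X \<longleftrightarrow> X \<subseteq> states G \<and> (\<forall>s\<in>X. enabled X s \<noteq> {})"

text \<open>The choices of both players are merged into one function \<open>\<rho>\<close> on histories.\<close>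

definition step :: "(('s + 'a) list \<Rightarrow> 'a) \<Rightarrow> ('s + 'a) list \<Rightarrow> ('s + 'a) list \<Rightarrow> bool" where
  "step \<rho> u v \<longleftrightarrow> (\<exists>t. v = u @ [Inr (\<rho> u), Inl t] \<and> (label u, \<rho> u, t) \<in> trans_rel G)"

abbreviation desc :: "(('s + 'a) list \<Rightarrow> 'a) \<Rightarrow> ('s + 'a) list \<Rightarrow> ('s + 'a) list \<Rightarrow> bool" where
  "desc \<rho> \<equiv> (step \<rho>)\<^sup>*\<^sup>*"

definition settled :: "(('s + 'a) list \<Rightarrow> 'a) \<Rightarrow> nat \<Rightarrow> ('s + 'a) list \<Rightarrow> bool" where
  "settled \<rho> m u \<longleftrightarrow>
     (\<forall>v. desc \<rho> u v \<longrightarrow> \<chi> (label v) \<le> m \<and> (\<exists>w. desc \<rho> v w \<and> \<chi> (label w) = m))"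

definition can_win :: "bool \<Rightarrow> (('s + 'a) list \<Rightarrow> 'a) \<Rightarrow> ('s + 'a) list \<Rightarrow> bool" where
  "can_win e \<rho> u \<longleftrightarrow> (\<exists>v m. desc \<rho> u v \<and> settled \<rho> m v \<and> even m = e)"

text \<open>The play stays in \<open>X\<close>, but player \<open>e\<close> follows \<open>f\<close>
  only on \<open>D\<close>, since an attractor prescribes choices on a part of the arena. All other
  choices are free and may use the whole history.\<close>

definition conform ::
  "bool \<Rightarrow> 's set \<Rightarrow> 's set \<Rightarrow> ('s \<Rightarrow> 'a) \<Rightarrow> (('s + 'a) list \<Rightarrow> 'a) \<Rightarrow> ('s + 'a) list \<Rightarrow> bool" where
  "conform e X D f \<rho> u \<longleftrightarrow> (\<forall>v. desc \<rho> u v \<longrightarrow>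
     label v \<in> X \<and> \<rho> v \<in> actions G \<and> (label v \<in> own e \<inter> D \<longrightarrow> \<rho> v = f (label v)))"

text \<open>Conforming passes to descendants, so \<open>can_win\<close> in fact holds at every
  descendant of \<open>u\<close>: this is the density of settled histories.\<close>

definition wins :: "bool \<Rightarrow> 's set \<Rightarrow> ('s \<Rightarrow> 'a) \<Rightarrow> bool" where
  "wins e X f \<longleftrightarrow> (\<forall>s\<in>X \<inter> own e. f s \<in> enabled X s) \<and>
     (\<forall>\<rho> u. conform e X X f \<rho> u \<longrightarrow> can_win e \<rho> u)"

text \<open>The opponent of \<open>e\<close> cannot leave \<open>Z\<close> by moves that are safe in \<open>X\<close>.\<close>

definition closed :: "bool \<Rightarrow> 's set \<Rightarrow> 's set \<Rightarrow> bool" where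
  "closed e X Z \<longleftrightarrow> Z \<subseteq> X \<and> (\<forall>s\<in>Z \<inter> own (\<not> e). enabled X s \<subseteq> enabled Z s)"

definition region :: "bool \<Rightarrow> 's set \<Rightarrow> 's set \<Rightarrow> bool" where
  "region e X Z \<longleftrightarrow> Z \<noteq> {} \<and> closed e X Z \<and> (\<exists>f. wins e Z f)"

text \<open>Unlike in the usual attractor, a single descendant has to reach \<open>T\<close>:
  successors are cooperative, as Banach or Mazur can steer there. Only the opponent's choice of
  actions is adversarial.\<close>

definition attracts :: "bool \<Rightarrow> 's set \<Rightarrow> 's set \<Rightarrow> 's set \<Rightarrow> ('s \<Rightarrow> 'a) \<Rightarrow> bool" where
  "attracts e X T B f \<longleftrightarrow> (\<forall>s\<in>(B - T) \<inter> own e. f s \<in> enabled X s) \<and>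
     (\<forall>\<rho> u. label u \<in> B \<longrightarrow> conform e X (B - T) f \<rho> u \<longrightarrow> (\<exists>v. desc \<rho> u v \<and> label v \<in> T))"

section \<open>Elementary facts on conforming histories\<close>

lemma finite_states: "finite (states G)"
  using game by (simp add: bm_game_def)

lemma own_cases: "s \<in> states G \<Longrightarrow> s \<in> own e \<or> s \<in> own (\<not> e)"
  using game by (auto simp: bm_game_def own_def)

lemma successor_exists:
  assumes "s \<in> states G" "a \<in> actions G"
  obtains t where "(s, a, t) \<in> trans_rel G"
  using game assms by (fastforce simp: bm_game_def)

lemma enabled_mono: "X \<subseteq> Y \<Longrightarrow> enabled X s \<subseteq> enabled Y s"
  by (auto simp: enabled_def)

lemma enabled_states: "s \<in> states G \<Longrightarrow> enabled (states G) s = actions G"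
  using game by (auto simp: bm_game_def enabled_def)

lemma step_label: "step \<rho> u v \<Longrightarrow> (label u, \<rho> u, label v) \<in> trans_rel G"
  by (auto simp: step_def)

lemma step_exists:
  assumes "(label u, \<rho> u, t) \<in> trans_rel G"
  shows "\<exists>v. step \<rho> u v \<and> label v = t"
  using assms by (intro exI[of _ "u @ [Inr (\<rho> u), Inl t]"]) (simp add: step_def)

lemma conform_desc: "conform e X D f \<rho> u \<Longrightarrow> desc \<rho> u v \<Longrightarrow> conform e X D f \<rho> v"
  unfolding conform_def by (meson rtranclp_trans)

lemma conform_label: "conform e X D f \<rho> u \<Longrightarrow> label u \<in> X"
  unfolding conform_def by blast

lemma conform_enabled:
  assumes "conform e X D f \<rho> u"
  shows "\<rho> u \<in> enabled X (label u)"
proof -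
  have "t \<in> X" if t: "(label u, \<rho> u, t) \<in> trans_rel G" for t
  proof -
    obtain v where "step \<rho> u v" "label v = t" using step_exists t by blast
    then show ?thesis using assms unfolding conform_def by blast
  qed
  then show ?thesis using assms unfolding conform_def enabled_def by blast
qed

lemma conform_choice: "conform e X D f \<rho> u \<Longrightarrow> label u \<in> own e \<Longrightarrow> label u \<in> D \<Longrightarrow> \<rho> u = f (label u)"
  unfolding conform_def by blast

lemma conform_mono:
  assumes "conform e X D f \<rho> u" "D' \<subseteq> D" "\<And>s. s \<in> D' \<Longrightarrow> f s = f' s"
  shows "conform e X D' f' \<rho> u"
  using assms by (auto simp: conform_def subset_iff)

lemma conform_restrict:
  assumes "conform e X D f \<rho> u" "\<And>v. desc \<rho> u v \<Longrightarrow> label v \<in> Z"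
  shows "conform e Z D f \<rho> u"
  using assms by (simp add: conform_def)

text \<open>Induction along the descendants: \<open>f\<close> keeps the play in \<open>Z\<close> at
  the states of \<open>e\<close>, and \<open>closed\<close> does so at those of the opponent, whose
  actions are safe in \<open>X\<close>.\<close>

lemma conform_closed:
  assumes c: "conform e X D f \<rho> u" and u: "label u \<in> Z" and Z: "closed e X Z" "Z \<subseteq> D" "X \<subseteq> states G"
    and f: "\<And>s. s \<in> Z \<inter> own e \<Longrightarrow> f s \<in> enabled Z s"
  shows "conform e Z Z f \<rho> u"
proof -
  have "label v \<in> Z" if "desc \<rho> u v" for v
    using that
  proof (induction rule: rtranclp_induct)
    case (step v w)
    have cv: "conform e X D f \<rho> v" using conform_desc[OF c step.hyps(1)] .
    have "\<rho> v \<in> enabled Z (label v)"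
    proof (cases "label v \<in> own e")
      case True
      then show ?thesis using f[of "label v"] step.IH Z(2) conform_choice[OF cv] by auto
    next
      case False
      then have "label v \<in> own (\<not> e)" using own_cases[of "label v" e] step.IH Z by (auto simp: closed_def)
      then show ?thesis using conform_enabled[OF cv] step.IH Z(1) by (auto simp: closed_def)
    qed
    then show ?case using step_label[OF step.hyps(2)] by (auto simp: enabled_def)
  qed (rule u)
  then show ?thesis by (rule conform_mono[OF conform_restrict[OF c] Z(2)]) auto
qed

lemma can_win_desc: "desc \<rho> u v \<Longrightarrow> can_win e \<rho> v \<Longrightarrow> can_win e \<rho> u"
  unfolding can_win_def by (meson rtranclp_trans)

lemma settled_desc: "settled \<rho> m u \<Longrightarrow> desc \<rho> u v \<Longrightarrow> settled \<rho> m v"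
  unfolding settled_def by (meson rtranclp_trans)

lemma settled_unique: "settled \<rho> m u \<Longrightarrow> settled \<rho> n u \<Longrightarrow> m = n"
  unfolding settled_def by (metis le_antisym rtranclp.rtrancl_refl)

section \<open>Closed sets and attractors\<close>

lemma closed_trans:
  assumes "closed e X Y" "closed e Y Z"
  shows "closed e X Z"
  using assms unfolding closed_def by blast

lemma closed_refl: "closed e X X"
  unfolding closed_def by blast

text \<open>One successor in \<open>B\<close> is enough to reach \<open>T\<close> from
  \<open>s\<close>. As \<open>s\<close> is not in \<open>B\<close>, redefining \<open>f\<close> at
  \<open>s\<close> leaves the choices on \<open>B\<close> intact, so the old attraction applies from
  that successor on.\<close>

lemma attracts_insert:
  assumes B: "attracts e X T B f" "T \<subseteq> B" and s: "s \<in> X" "s \<notin> B"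
    and own: "s \<in> own e \<Longrightarrow> a \<in> enabled X s \<and> (\<exists>t\<in>B. (s, a, t) \<in> trans_rel G)"
    and opp: "s \<notin> own e \<Longrightarrow> \<forall>a\<in>enabled X s. \<exists>t\<in>B. (s, a, t) \<in> trans_rel G"
  shows "attracts e X T (insert s B) (f(s := a))"
  unfolding attracts_def
proof (intro conjI ballI allI impI)
  fix r assume "r \<in> (insert s B - T) \<inter> own e"
  then show "(f(s := a)) r \<in> enabled X r" using B(1) own unfolding attracts_def by auto
next
  fix \<rho> u
  assume u: "label u \<in> insert s B" and c: "conform e X (insert s B - T) (f(s := a)) \<rho> u"
  have c': "conform e X (B - T) f \<rho> u"
    by (rule conform_mono[OF c]) (use s(2) in auto)
  have reach: "\<exists>v. desc \<rho> w v \<and> label v \<in> T" if "desc \<rho> u w" "label w \<in> B" for w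
    using that B(1) conform_desc[OF c' that(1)] unfolding attracts_def by blast
  show "\<exists>v. desc \<rho> u v \<and> label v \<in> T"
  proof (cases "label u = s")
    case True
    have "\<exists>t\<in>B. (s, \<rho> u, t) \<in> trans_rel G"
    proof (cases "s \<in> own e")
      case True
      then have "\<rho> u = a" using conform_choice[OF c] \<open>label u = s\<close> s(2) B(2) by auto
      then show ?thesis using own True by blast
    next
      case False
      then show ?thesis using opp conform_enabled[OF c] True by blast
    qed
    then obtain t where t: "t \<in> B" "(label u, \<rho> u, t) \<in> trans_rel G" using True by blast
    obtain w where w: "step \<rho> u w" "label w = t" using step_exists t(2) by blast
    then obtain v where "desc \<rho> w v" "label v \<in> T" using reach[of w] t(1) by blast
    then show ?thesis using w(1) by (meson converse_rtranclp_into_rtranclp)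
  next
    case False
    then show ?thesis using reach[of u] u by blast
  qed
qed

text \<open>A maximal attracted set takes the place of ranks: a state violating the properties of the
  complement could be added to it without changing the choices made so far.\<close>

lemma attractor_exists:
  assumes X: "arena X" and T: "T \<subseteq> X"
  obtains B f where "T \<subseteq> B" "B \<subseteq> X" "attracts e X T B f" "arena (X - B)" "closed (\<not> e) X (X - B)"
proof -
  let ?P = "\<lambda>B. T \<subseteq> B \<and> B \<subseteq> X \<and> (\<exists>f. attracts e X T B f)"
  have fin: "finite X" using X finite_states finite_subset unfolding arena_def by blast
  have base: "?P T" using T unfolding attracts_def by auto
  obtain B where B: "?P B" and max: "\<And>C. ?P C \<Longrightarrow> B \<subseteq> C \<Longrightarrow> C = B"
    using maximal_set_exists[of X ?P T, OF fin base] by blast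
  then obtain f where f: "attracts e X T B f" by blast
  have own: "enabled X s \<subseteq> enabled (X - B) s" if s: "s \<in> X - B" "s \<in> own e" for s
  proof (rule ccontr)
    assume "\<not> ?thesis"
    then obtain a t where "a \<in> enabled X s" "(s, a, t) \<in> trans_rel G" "t \<in> B"
      unfolding enabled_def by blast
    then have "attracts e X T (insert s B) (f(s := a))"
      using attracts_insert[OF f, of s a] B s by blast
    then have "?P (insert s B)" using B s by blast
    then show False using max[of "insert s B"] s by blast
  qed
  have opp: "enabled (X - B) s \<noteq> {}" if s: "s \<in> X - B" "s \<notin> own e" for s
  proof
    assume "enabled (X - B) s = {}"
    then have "\<forall>a\<in>enabled X s. \<exists>t\<in>B. (s, a, t) \<in> trans_rel G"
      unfolding enabled_def by blast
    \<comment> \<open>The value \<open>undefined\<close> is harmless: at a state not owned by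
      \<open>e\<close> the function is never consulted.\<close>
    then have "attracts e X T (insert s B) (f(s := undefined))"
      using attracts_insert[OF f, of s undefined] B s by blast
    then have "?P (insert s B)" using B s by blast
    then show False using max[of "insert s B"] s by blast
  qed
  have "arena (X - B)"
    unfolding arena_def
  proof (intro conjI ballI)
    fix s assume s: "s \<in> X - B"
    then have "enabled X s \<noteq> {}" using X unfolding arena_def by blast
    then show "enabled (X - B) s \<noteq> {}" using own[OF s] opp[OF s] by blast
  qed (use X in \<open>auto simp: arena_def\<close>)
  moreover have "closed (\<not> e) X (X - B)" using own by (auto simp: closed_def)
  ultimately show thesis using that B f by blast
qed

section \<open>Gluing winning choices, and the dichotomy\<close>

text \<open>Either some descendant never meets \<open>B\<close> again, and \<open>h\<close> wins
  there, or every descendant can reach \<open>B\<close> and from it \<open>T\<close>. What the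
  latter is worth is left to the last hypothesis, so that one argument serves both for a top
  priority and for a region already won.\<close>

lemma wins_glue:
  assumes X: "arena X" and B: "T \<subseteq> B" "B \<subseteq> X" "attracts e X T B g" and h: "wins e (X - B) h"
    and f2: "\<And>s. s \<in> T \<inter> own e \<Longrightarrow> f2 s \<in> enabled X s"
    and T: "\<And>f \<rho> u. conform e X X f \<rho> u \<Longrightarrow> (\<And>s. s \<in> T \<Longrightarrow> f s = f2 s) \<Longrightarrow>
      (\<And>v. desc \<rho> u v \<Longrightarrow> \<exists>w. desc \<rho> v w \<and> label w \<in> T) \<Longrightarrow> can_win e \<rho> u"
  shows "\<exists>f. wins e X f"
proof -
  let ?f = "\<lambda>s. if s \<in> T then f2 s else if s \<in> B then g s else h s"
  have "wins e X ?f"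
    unfolding wins_def
  proof (intro conjI ballI allI impI)
    fix s assume s: "s \<in> X \<inter> own e"
    have "h s \<in> enabled X s" if "s \<notin> B"
      using that h s enabled_mono[of "X - B" X s] unfolding wins_def by blast
    then show "?f s \<in> enabled X s" using s f2 B(3) unfolding attracts_def by auto
  next
    fix \<rho> u assume c: "conform e X X ?f \<rho> u"
    show "can_win e \<rho> u"
    proof (cases "\<exists>v. desc \<rho> u v \<and> (\<forall>w. desc \<rho> v w \<longrightarrow> label w \<in> X - B)")
      case True
      then obtain v where v: "desc \<rho> u v" "\<And>w. desc \<rho> v w \<Longrightarrow> label w \<in> X - B" by blast
      have "conform e (X - B) (X - B) h \<rho> v"
        by (rule conform_restrict[OF conform_mono[OF conform_desc[OF c v(1)]]]) (use v(2) B(1) in auto)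
      then show ?thesis using can_win_desc[OF v(1)] h unfolding wins_def by blast
    next
      case False
      show ?thesis
      proof (rule T[OF c])
        fix v assume v: "desc \<rho> u v"
        then obtain w where w: "desc \<rho> v w" "label w \<in> B"
          using False c unfolding conform_def by (meson Diff_iff rtranclp_trans)
        have cw: "conform e X X ?f \<rho> w" using conform_desc[OF c] v w(1) by (meson rtranclp_trans)
        have "conform e X (B - T) g \<rho> w" using conform_mono[OF cw, of "B - T" g] B(2) by auto
        then obtain x where "desc \<rho> w x" "label x \<in> T" using B(3) w(2) unfolding attracts_def by blast
        then show "\<exists>w. desc \<rho> v w \<and> label w \<in> T" using w(1) by (meson rtranclp_trans)
      qed simp
    qed
  qed
  then show ?thesis by blast
qed

text \<open>If the top priority \<open>m\<close> can be reached again from every descendant, the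
  current history is itself settled. Any safe action will do at the states of priority
  \<open>m\<close>.\<close>

lemma wins_via_top_priority:
  assumes X: "arena X" and m: "\<And>s. s \<in> X \<Longrightarrow> \<chi> s \<le> m" and e: "even m = e"
    and B: "{s \<in> X. \<chi> s = m} \<subseteq> B" "B \<subseteq> X" "attracts e X {s \<in> X. \<chi> s = m} B g"
    and h: "wins e (X - B) h"
  shows "\<exists>f. wins e X f"
proof (rule wins_glue[where ?f2.0 = "\<lambda>s. SOME a. a \<in> enabled X s", OF X B h])
  fix s assume "s \<in> {s \<in> X. \<chi> s = m} \<inter> own e"
  then show "(SOME a. a \<in> enabled X s) \<in> enabled X s"
    using X some_in_eq unfolding arena_def by blast
next
  fix f \<rho> u
  assume c: "conform e X X f \<rho> u"
    and d: "\<And>v. desc \<rho> u v \<Longrightarrow> \<exists>w. desc \<rho> v w \<and> label w \<in> {s \<in> X. \<chi> s = m}"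
  have "settled \<rho> m u"
    unfolding settled_def using m c d unfolding conform_def by blast
  then show "can_win e \<rho> u" unfolding can_win_def using e by blast
qed

text \<open>One visit to \<open>Z\<close> decides: following \<open>k\<close> there makes
  \<open>Z\<close> a trap, and \<open>k\<close> wins in it.\<close>

lemma wins_via_region:
  assumes X: "arena X" and Z: "closed e X Z" "wins e Z k"
    and B: "Z \<subseteq> B" "B \<subseteq> X" "attracts e X Z B g" and h: "wins e (X - B) h"
  shows "\<exists>f. wins e X f"
proof (rule wins_glue[where ?f2.0 = k, OF X B h])
  have k: "k s \<in> enabled Z s" if "s \<in> Z \<inter> own e" for s using that Z(2) unfolding wins_def by blast
  have ZX: "Z \<subseteq> X" using Z(1) unfolding closed_def by blast
  then show "k s \<in> enabled X s" if "s \<in> Z \<inter> own e" for s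
    using that k enabled_mono by blast
  fix f \<rho> u
  assume c: "conform e X X f \<rho> u" and f: "\<And>s. s \<in> Z \<Longrightarrow> f s = k s"
    and d: "\<And>v. desc \<rho> u v \<Longrightarrow> \<exists>w. desc \<rho> v w \<and> label w \<in> Z"
  obtain w where w: "desc \<rho> u w" "label w \<in> Z" using d[of u] by blast
  have "conform e Z Z f \<rho> w"
    by (rule conform_closed[OF conform_desc[OF c w(1)] w(2) Z(1) ZX])
      (use X f k in \<open>auto simp: arena_def\<close>)
  then have "conform e Z Z k \<rho> w" using conform_mono[of e Z Z f \<rho> w Z k] f by blast
  then show "can_win e \<rho> u" using can_win_desc[OF w(1)] Z(2) unfolding wins_def by blast
qed

lemma region_closed: "closed e X Y \<Longrightarrow> region e Y Z \<Longrightarrow> region e X Z"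
  unfolding region_def using closed_trans by blast

lemma wins_empty: "wins e {} f"
  unfolding wins_def conform_def by blast

lemma dichotomy:
  assumes "arena X"
  shows "(\<exists>f. wins e X f) \<or> (\<exists>Z. region (\<not> e) X Z)"
proof -
  have "finite X" using assms finite_states finite_subset unfolding arena_def by blast
  then show ?thesis using assms
  proof (induction X arbitrary: e rule: finite_psubset_induct)
    case (psubset X)
    show ?case
    proof (cases "X = {}")
      case True
      then show ?thesis using wins_empty by blast
    next
      case False
      define m where "m = Max (\<chi> ` X)"
      define d where "d = even m"
      have m: "\<chi> s \<le> m" if "s \<in> X" for s using that psubset.hyps(1) unfolding m_def by simp
      have "m \<in> \<chi> ` X" unfolding m_def using False psubset.hyps(1) by simp
      then obtain s0 where s0: "s0 \<in> X" "\<chi> s0 = m" by blast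
      \<comment> \<open>Removing the attractor of the top priority shrinks the arena, as
        \<open>s0\<close> is gone. If \<open>d\<close> wins on the rest, gluing gives all of
        \<open>X\<close>; otherwise the opponent's region there is one of \<open>X\<close>, as
        \<open>d\<close> cannot leave the complement of its own attractor.\<close>
      have D: "(\<exists>f. wins d X f) \<or> (\<exists>Z. region (\<not> d) X Z)"
      proof -
        obtain B g where B: "{s \<in> X. \<chi> s = m} \<subseteq> B" "B \<subseteq> X" "attracts d X {s \<in> X. \<chi> s = m} B g"
            "arena (X - B)" "closed (\<not> d) X (X - B)"
          using attractor_exists[OF psubset.prems, of "{s \<in> X. \<chi> s = m}" d] by blast
        have "X - B \<subset> X" using B(1) s0 by blast
        from psubset.IH[OF this B(4), of d] show ?thesis
          using wins_via_top_priority[OF psubset.prems m _ B(1-3)] region_closed[OF B(5)] d_def by blast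
      qed
      show ?thesis
      proof (cases "e = d")
        case True
        then show ?thesis using D by simp
      next
        case False
        then have e: "e = (\<not> d)" by blast
        \<comment> \<open>The result for \<open>d\<close> is reused: if \<open>d\<close> wins on all
          of \<open>X\<close>, then \<open>X\<close> itself is a region of the opponent of
          \<open>e\<close>; if not, \<open>e\<close> has a region, and its attractor is
          removed.\<close>
        show ?thesis
        proof (cases "\<exists>f. wins d X f")
          case True
          then have "region (\<not> e) X X" using \<open>X \<noteq> {}\<close> e closed_refl unfolding region_def by simp
          then show ?thesis by blast
        next
          case False
          then obtain Z k where Z: "Z \<noteq> {}" "closed e X Z" "wins e Z k"
            using D e unfolding region_def by blast
          then have ZX: "Z \<subseteq> X" unfolding closed_def by blast
          obtain B g where B: "Z \<subseteq> B" "B \<subseteq> X" "attracts e X Z B g"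
              "arena (X - B)" "closed (\<not> e) X (X - B)"
            using attractor_exists[OF psubset.prems ZX, of e] by blast
          have "X - B \<subset> X" using B(1,2) Z(1) by blast
          from psubset.IH[OF this B(4), of e] show ?thesis
            using wins_via_region[OF psubset.prems Z(2,3) B(1-3)] region_closed[OF B(5)] by blast
        qed
      qed
    qed
  qed
qed

section \<open>The partition into the winning sets of both players\<close>

text \<open>Adam's regions are peeled off with their attractors until Eve wins on the rest. Plays
  may wander back into \<open>X\<close>, where \<open>g\<close> does not bind Adam:
  \<open>can_win\<close> is claimed only for histories ending outside \<open>X\<close>, which
  suffices as Mazur moves first.\<close>

lemma winning_partition:
  assumes X: "arena X" "closed True (states G) X"
    and g: "\<And>s. s \<in> states G - X \<Longrightarrow> g s \<in> actions G"
    and win: "\<And>\<rho> u. conform False (states G) (states G - X) g \<rho> u \<Longrightarrow> label u \<notin> X \<Longrightarrow> can_win False \<rho> u"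
  shows "\<exists>Y f g. closed True (states G) Y \<and> wins True Y f \<and> (\<forall>s\<in>states G - Y. g s \<in> actions G) \<and>
    (\<forall>\<rho> u. conform False (states G) (states G - Y) g \<rho> u \<longrightarrow> label u \<notin> Y \<longrightarrow> can_win False \<rho> u)"
proof -
  have "finite X" using X finite_states finite_subset unfolding arena_def by blast
  then show ?thesis using assms
  proof (induction X arbitrary: g rule: finite_psubset_induct)
    case (psubset X)
    consider f where "wins True X f" | Z where "region False X Z"
      using dichotomy[OF psubset.prems(1), of True] by auto
    then show ?case
    proof cases
      case 1
      then show ?thesis using psubset.prems by blast
    next
      case 2
      then obtain k where Z: "Z \<noteq> {}" "closed False X Z" "wins False Z k" unfolding region_def by blast
      then have ZX: "Z \<subseteq> X" unfolding closed_def by blast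
      have XS: "X \<subseteq> states G" using psubset.prems(1) unfolding arena_def by blast
      obtain B b where B: "Z \<subseteq> B" "B \<subseteq> X" "attracts False X Z B b"
          "arena (X - B)" "closed True X (X - B)"
        using attractor_exists[OF psubset.prems(1) ZX, of False] by auto
      obtain a0 where a0: "a0 \<in> actions G" using game unfolding bm_game_def by blast
      \<comment> \<open>Choices of earlier rounds are kept. \<open>k\<close> and \<open>b\<close>
        are known to be legal only at Adam's states, while \<open>h\<close> must give an action at
        every peeled state, hence the default \<open>a0\<close>.\<close>
      define h where "h s = (if s \<notin> X then g s else if s \<notin> own False then a0 
        else if s \<in> Z then k s else b s)" for s
      have act: "enabled V s \<subseteq> actions G" for V s unfolding enabled_def by blast
      show ?thesis
      proof (rule psubset.IH[of "X - B" h])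
        show "X - B \<subset> X" using B(1,2) Z(1) by blast
        show "arena (X - B)" by fact
        show "closed True (states G) (X - B)" using closed_trans[OF psubset.prems(2) B(5)] .
        show "h s \<in> actions G" if s: "s \<in> states G - (X - B)" for s
        proof -
          consider "s \<notin> X" | "s \<in> X" "s \<notin> own False" | "s \<in> Z" "s \<in> X" "s \<in> own False"
            | "s \<in> B - Z" "s \<in> X" "s \<in> own False" using s by blast
          then show ?thesis
          proof cases
            case 1
            then show ?thesis using s psubset.prems(3)[of s] unfolding h_def by simp
          next
            case 2
            then show ?thesis using a0 unfolding h_def by simp
          next
            case 3
            then have "k s \<in> actions G" using Z(3) act unfolding wins_def by blast
            then show ?thesis using 3 unfolding h_def by simp
          next
            case 4
            then have "b s \<in> actions G" using B(3) act unfolding attracts_def by blast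
            then show ?thesis using 4 unfolding h_def by simp
          qed
        qed
      next
        fix \<rho> u
        assume c: "conform False (states G) (states G - (X - B)) h \<rho> u" and u: "label u \<notin> X - B"
        \<comment> \<open>\<open>Z\<close> is closed only relative to \<open>X\<close>, so a play
          may escape by leaving \<open>X\<close>. If some descendant does, the earlier choices win
          there; otherwise all descendants stay in \<open>X\<close>, and Adam can reach
          \<open>Z\<close> and win inside it.\<close>
        show "can_win False \<rho> u"
        proof (cases "\<exists>v. desc \<rho> u v \<and> label v \<notin> X")
          case True
          then obtain v where v: "desc \<rho> u v" "label v \<notin> X" by blast
          have "conform False (states G) (states G - X) g \<rho> v"
            using conform_mono[OF conform_desc[OF c v(1)], of "states G - X" g] by (auto simp: h_def)
          then show ?thesis using psubset.prems(4) v can_win_desc by blast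
        next
          case False
          then have cX: "conform False X (states G - (X - B)) h \<rho> u" using conform_restrict[OF c] by blast
          have "label u \<in> B" using u conform_label[OF cX] by blast
          moreover have "conform False X (B - Z) b \<rho> u"
            using cX B(2) XS unfolding conform_def h_def by auto
          ultimately obtain w where w: "desc \<rho> u w" "label w \<in> Z"
            using B(3) unfolding attracts_def by blast
          have "conform False Z Z h \<rho> w"
          proof (rule conform_closed[OF conform_desc[OF cX w(1)] w(2) Z(2)])
            show "h s \<in> enabled Z s" if "s \<in> Z \<inter> own False" for s
              using that Z(3) ZX unfolding h_def wins_def by auto
          qed (use B XS ZX in auto)
          then have "conform False Z Z k \<rho> w" using ZX unfolding conform_def h_def by auto
          then show ?thesis using Z(3) can_win_desc[OF w(1)] unfolding wins_def by blast
        qed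
      qed
    qed
  qed
qed

end

section \<open>The tree of one merged choice function and its branches\<close>

locale play_tree = priority_game G \<chi> for G :: "('s, 'a) game" and \<chi> +
  fixes \<rho> :: "('s + 'a) list \<Rightarrow> 'a" and s0 :: 's
  assumes legal: "\<And>v. desc \<rho> [Inl s0] v \<Longrightarrow> label v \<in> states G \<and> \<rho> v \<in> actions G"
begin

abbreviation node :: "('s + 'a) list \<Rightarrow> bool" where
  "node v \<equiv> desc \<rho> [Inl s0] v"

definition branches :: "('s + 'a) stream set" where
  "branches = {w. \<forall>n. node (stake (2 * n + 1) w)}"

lemma node_shape:
  assumes "node v"
  shows "odd (length v) \<and> (\<forall>i<length v. isl (v ! i) = even i)"
  using assms
proof (induction rule: rtranclp_induct)
  case (step v w)
  then obtain t where w: "w = v @ [Inr (\<rho> v), Inl t]" unfolding step_def by blast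
  have "isl (w ! i) = even i" if i: "i < length w" for i
  proof -
    consider "i < length v" | "i = length v" | "i = Suc (length v)" using i w by fastforce
    then show ?thesis using step.IH w by cases (auto simp: nth_append)
  qed
  then show ?case using step.IH w by simp
qed auto

text \<open>Nodes have odd length, so a node that is a prefix of a child cannot stop right after the
  action: it is the child or a prefix of the parent.\<close>

lemma prefix_node_desc:
  assumes "node v" "node u" "prefix u v"
  shows "desc \<rho> u v"
  using assms(1,3)
proof (induction rule: rtranclp_induct)
  case base
  have "u \<noteq> []" using node_shape[OF assms(2)] by auto
  then have "u = [Inl s0]" using base by (auto simp: prefix_Cons)
  then show ?case by simp
next
  case (step v w)
  obtain t where w: "w = v @ [Inr (\<rho> v), Inl t]" using step.hyps(2) unfolding step_def by blast
  have "odd (length u)" "odd (length v)" using node_shape assms(2) step.hyps(1) by auto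
  then have "length u \<noteq> Suc (length v)" by auto
  then consider "u = w" | "prefix u v"
    using step.prems w prefix_snoc[of u "v @ [Inr (\<rho> v)]" "Inl t"] by (auto simp: prefix_snoc)
  then show ?case using step by cases (auto intro: rtranclp.rtrancl_into_rtrancl)
qed

lemma desc_prefix: "desc \<rho> u v \<Longrightarrow> prefix u v"
proof (induction rule: rtranclp_induct)
  case (step v w)
  then show ?case unfolding step_def by (auto intro: prefix_order.trans)
qed simp

lemma take_node:
  assumes "node v" "odd k" "k \<le> length v"
  shows "node (take k v)"
  using assms(1,3)
proof (induction rule: rtranclp_induct)
  case base
  then have "k = 1" using assms(2) by (cases k) auto
  then show ?case by simp
next
  case (step v w)
  obtain t where w: "w = v @ [Inr (\<rho> v), Inl t]" using step.hyps(2) unfolding step_def by blast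
  have "odd (length v)" using node_shape step.hyps(1) by auto
  then have "k \<noteq> Suc (length v)" using assms(2) by auto
  then consider "k \<le> length v" | "k = length w" using step.prems w by force
  then show ?case using step w by cases (auto intro: rtranclp.rtrancl_into_rtrancl)
qed

lemma child_exists:
  assumes "node v"
  shows "\<exists>w. step \<rho> v w"
proof -
  obtain t where "(label v, \<rho> v, t) \<in> trans_rel G" using successor_exists legal[OF assms] by blast
  then show ?thesis using step_exists by blast
qed

text \<open>A move may end in an action, so the \<open>p k\<close> need not be nodes; extending to
  nodes is enough, as prefixes of odd length of nodes are nodes.\<close>

lemma limit_branch:
  assumes "\<And>n. p n = stake (length (p n)) w" "\<And>n. \<exists>k. n \<le> length (p k) \<and> (\<exists>v. node v \<and> prefix (p k) v)"
  shows "w \<in> branches"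
  unfolding branches_def
proof (intro CollectI allI)
  fix n
  obtain k v where k: "2 * n + 1 \<le> length (p k)" "node v" "prefix (p k) v" using assms(2) by blast
  have "stake (2 * n + 1) w = take (2 * n + 1) (p k)"
    using take_stake_le[OF k(1), of w] assms(1)[of k] by simp
  also have "\<dots> = take (2 * n + 1) v" using k(1,3) by (auto simp: prefix_def)
  finally show "node (stake (2 * n + 1) w)"
    using take_node[OF k(2), of "2 * n + 1"] k(1) prefix_length_le[OF k(3)] by simp
qed

lemma node_in_prefixes:
  assumes "node v"
  shows "v \<in> prefixes_of branches"
proof -
  define p where "p n = ((\<lambda>u. SOME w. step \<rho> u w) ^^ n) v" for n
  have nd: "node (p n) \<and> step \<rho> (p n) (p (Suc n))" for n
  proof (induction n)
    case 0
    then show ?case using assms someI_ex[OF child_exists[OF assms]] by (simp add: p_def)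
  next
    case (Suc n)
    then have "node (p (Suc n))" by (meson rtranclp.rtrancl_into_rtrancl)
    then show ?case using someI_ex[OF child_exists] by (simp add: p_def)
  qed
  then have chain: "strict_prefix (p n) (p (Suc n))" for n unfolding step_def by (metis strict_prefixI' append_Cons append_Nil)
  obtain w where w: "\<And>n. p n = stake (length (p n)) w" using strict_chain_limit[of p, OF chain] by blast
  have "w \<in> branches"
    by (rule limit_branch[of p, OF w]) (meson strict_chain_length[of p, OF chain] nd prefix_order.refl)
  moreover have "v = stake (length v) w" using w[of 0] by (simp add: p_def)
  ultimately show ?thesis unfolding prefixes_of_def by blast
qed

lemma prefixes_extend:
  assumes "q \<in> prefixes_of branches"
  obtains x where "node x" "strict_prefix q x"
proof -
  obtain n w where q: "q = stake n w" "w \<in> branches" using assms unfolding prefixes_of_def by blast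
  \<comment> \<open>The length \<open>2 * n + 1\<close> is odd, hence that of a node on
    \<open>w\<close>, and exceeds \<open>n\<close> even for \<open>n = 0\<close>.\<close>
  have "strict_prefix q (stake (2 * n + 1) w)"
  proof (rule strict_prefixI)
    show "prefix q (stake (2 * n + 1) w)"
      using take_is_prefix[of n "stake (2 * n + 1) w"] q(1) take_stake_le[of n "2 * n + 1" w] by simp
    show "q \<noteq> stake (2 * n + 1) w" using q(1) by (metis length_stake less_add_one mult_2 not_add_less1 trans_less_add1)
  qed
  then show thesis using that q(2) unfolding branches_def by blast
qed

lemma play_limit:
  assumes "bm_play branches p"
  shows "strict_prefix (p n) (p (Suc n))" "p n \<in> prefixes_of branches"
    "bm_limit p \<in> branches" "p n = stake (length (p n)) (bm_limit p)"
proof -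
  have pos: "bm_position branches (map p [0..<n])" for n using assms unfolding bm_play_def by blast
  have chain: "strict_prefix (p n) (p (Suc n))" for n
    using pos[of "Suc (Suc n)"] unfolding bm_position_def
    by (simp add: successively_append_iff)
  have pre: "p n \<in> prefixes_of branches" for n
    using pos[of "Suc n"] unfolding bm_position_def by simp
  obtain w where w: "\<And>n. p n = stake (length (p n)) w" using strict_chain_limit[of p, OF chain] by blast
  have lim: "bm_limit p = w"
    unfolding bm_limit_def
  proof (rule the_equality)
    show "\<forall>n. \<exists>k. p n = stake k w" using w by blast
    fix w' assume w': "\<forall>n. \<exists>k. p n = stake k w'"
    have "w' !! i = w !! i" for i
    proof -
      have "length (p (Suc i)) > i" using strict_chain_length[of p "Suc i", OF chain] by simp
      moreover obtain k where "p (Suc i) = stake k w'" using w' by blast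
      moreover have "p (Suc i) = stake (length (p (Suc i))) w" using w .
      ultimately show ?thesis by (metis length_stake stake_nth)
    qed
    then have "snth w' = snth w" by blast
    then show "w' = w" by (metis stream_smap_nats)
  qed
  have "w \<in> branches"
    by (rule limit_branch[of p, OF w])
      (meson strict_chain_length[of p, OF chain] pre prefixes_extend prefix_order.less_imp_le)
  then show "strict_prefix (p n) (p (Suc n))" "p n \<in> prefixes_of branches"
    "bm_limit p \<in> branches" "p n = stake (length (p n)) (bm_limit p)"
    using chain pre lim w by auto
qed

lemma branch_projection:
  assumes "w \<in> branches"
  shows "smap projl (sfilter isl w) !! k = label (stake (2 * k + 1) w)"
proof -
  have alt: "isl (w !! i) = even i" for i
  proof -
    have "node (stake (2 * i + 1) w)" using assms unfolding branches_def by blast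
    from node_shape[OF this] show ?thesis by (auto simp del: stake.simps)
  qed
  have "sfilter isl w !! k = w !! (2 * k)" by (rule sfilter_alternating) (simp_all add: alt del: snth.simps)
  moreover have "last (stake (2 * k + 1) w) = w !! (2 * k)"
    using stake_Suc[of "2 * k" w] by (simp del: stake.simps)
  ultimately show ?thesis by (simp add: label_def)
qed

text \<open>From index \<open>k0\<close> on, all prefixes lie below a settled history, so
  \<open>m\<close> bounds the priorities; as \<open>m\<close> also occurs infinitely often, it is
  the upper limit.\<close>

lemma branch_parity:
  assumes w: "w \<in> branches" and m: "settled \<rho> m (stake (2 * k0 + 1) w)"
    and inf: "\<And>n. \<exists>k\<ge>n. \<chi> (label (stake (2 * k + 1) w)) = m"
  shows "w \<in> parity_objective G \<chi> \<longleftrightarrow> even m"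
proof -
  let ?u = "smap projl (sfilter isl w)"
  have nd: "node (stake (2 * k + 1) w)" for k using w unfolding branches_def by blast
  have proj: "?u !! k = label (stake (2 * k + 1) w)" for k using branch_projection[OF w] .
  have "limsup (\<lambda>k. enat (\<chi> (?u !! k))) = enat m"
  proof (rule limsup_enat_eqI[where ?k0.0 = k0])
    fix k assume "k0 \<le> k"
    then have "prefix (stake (2 * k0 + 1) w) (stake (2 * k + 1) w)"
      using take_is_prefix take_stake_le[of "2 * k0 + 1" "2 * k + 1" w]
      by (metis add_le_mono1 mult_le_mono2)
    then have "desc \<rho> (stake (2 * k0 + 1) w) (stake (2 * k + 1) w)" using prefix_node_desc nd by blast
    then show "\<chi> (?u !! k) \<le> m" using m unfolding settled_def proj by blast
  qed (use inf proj in auto)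
  moreover have "?u \<in> streams (states G)"
    unfolding streams_iff_snth using proj legal[OF nd] by auto
  ultimately show ?thesis unfolding parity_objective_def parity_def by auto
qed

text \<open>Hits along one play are comparable, so they all have the same priority.\<close>

definition hit :: "bool \<Rightarrow> ('s + 'a) list \<Rightarrow> bool" where
  "hit e x \<longleftrightarrow> node x \<and> settled \<rho> (\<chi> (label x)) x \<and> even (\<chi> (label x)) = e"

lemma hits_parity:
  assumes p: "bm_play branches p" and inf: "\<And>n. \<exists>k\<ge>n. hit e (p k)"
  shows "bm_limit p \<in> parity_objective G \<chi> \<longleftrightarrow> e"
proof -
  let ?w = "bm_limit p"
  note lim = play_limit[OF p]
  have at: "\<exists>j\<ge>n. p k = stake (2 * j + 1) ?w" if "hit e (p k)" "2 * n + 1 \<le> k" for n k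
  proof -
    have "odd (length (p k))" using that node_shape unfolding hit_def by blast
    then obtain j where j: "length (p k) = 2 * j + 1" by (elim oddE)
    have "k \<le> length (p k)" by (rule strict_chain_length) (rule lim)
    then show ?thesis using j that(2) lim(4)[of k] by (intro exI[of _ j]) auto
  qed
  obtain k0 where k0: "k0 \<ge> 1" "hit e (p k0)" using inf by blast
  define m where "m = \<chi> (label (p k0))"
  obtain j0 where j0: "p k0 = stake (2 * j0 + 1) ?w" using at[OF k0(2), of 0] k0(1) by auto
  have set: "settled \<rho> m (p k0)" "even m = e" using k0 unfolding hit_def m_def by auto
  have "?w \<in> parity_objective G \<chi> \<longleftrightarrow> even m"
  proof (rule branch_parity[OF lim(3)])
    show "settled \<rho> m (stake (2 * j0 + 1) ?w)" using set j0 by simp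
    fix n
    obtain k where k: "k \<ge> max k0 (2 * n + 1)" "hit e (p k)" using inf by blast
    obtain j where j: "j \<ge> n" "p k = stake (2 * j + 1) ?w" using at[OF k(2)] k(1) by auto
    have "prefix (p k0) (p k)" by (rule strict_chain_prefix[of p, OF lim(1)]) (use k in auto)
    then have "desc \<rho> (p k0) (p k)" using prefix_node_desc k(2) k0(2) unfolding hit_def by blast
    then have "\<chi> (label (p k)) = m"
      using settled_desc[OF set(1)] settled_unique k(2) unfolding hit_def by blast
    then show "\<exists>k\<ge>n. \<chi> (label (stake (2 * k + 1) ?w)) = m" using j by metis
  qed
  then show ?thesis using set by simp
qed

section \<open>Winning strategies for Banach and Mazur\<close>

text \<open>A strategy must answer legally at every position, also where no hit lies ahead; hence
  the second branch.\<close>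

definition response :: "bool \<Rightarrow> ('s + 'a) list \<Rightarrow> ('s + 'a) list" where
  "response e q = (if \<exists>x. strict_prefix q x \<and> hit e x then SOME x. strict_prefix q x \<and> hit e x
     else SOME x. strict_prefix q x \<and> node x)"

lemma response_hit: "strict_prefix q x \<Longrightarrow> hit e x \<Longrightarrow> hit e (response e q)"
  unfolding response_def using someI_ex[of "\<lambda>x. strict_prefix q x \<and> hit e x"] by auto

lemma response_legal:
  assumes "q \<in> prefixes_of branches"
  shows "strict_prefix q (response e q)" "response e q \<in> prefixes_of branches"
proof -
  have "\<exists>x. strict_prefix q x \<and> node x" using prefixes_extend[OF assms] by blast
  then have "strict_prefix q (response e q) \<and> node (response e q)"
    unfolding response_def
    using someI_ex[of "\<lambda>x. strict_prefix q x \<and> hit e x"] someI_ex[of "\<lambda>x. strict_prefix q x \<and> node x"]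
    by (auto simp: hit_def)
  then show "strict_prefix q (response e q)" "response e q \<in> prefixes_of branches"
    using node_in_prefixes by auto
qed

lemma response_position:
  assumes "bm_position branches ws" "ws \<noteq> []"
  shows "bm_position branches (ws @ [response e (last ws)])"
proof -
  have "last ws \<in> prefixes_of branches" using assms unfolding bm_position_def by auto
  then show ?thesis using assms response_legal[of "last ws" e] unfolding bm_position_def
    by (auto simp: successively_append_iff)
qed

text \<open>A settled history need not end in its recurring priority, but some descendant does;
  being settled is inherited, so that descendant is a hit.\<close>

lemma can_win_hit:
  assumes "node u" "can_win e \<rho> u"
  obtains x where "desc \<rho> u x" "hit e x"
proof -
  obtain v m where v: "desc \<rho> u v" "settled \<rho> m v" "even m = e" using assms(2) unfolding can_win_def by blast
  obtain x where x: "desc \<rho> v x" "\<chi> (label x) = m" using v(2) unfolding settled_def by blast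
  have "desc \<rho> u x" using v(1) x(1) by (meson rtranclp_trans)
  moreover have "node x" using assms(1) calculation by (meson rtranclp_trans)
  ultimately show thesis using that settled_desc[OF v(2) x(1)] v(3) x(2) unfolding hit_def by blast
qed

lemma response_hit_can_win:
  assumes "q \<in> prefixes_of branches" "\<And>x. node x \<Longrightarrow> strict_prefix q x \<Longrightarrow> can_win e \<rho> x"
  shows "hit e (response e q)"
proof -
  obtain x where x: "node x" "strict_prefix q x" using prefixes_extend[OF assms(1)] .
  obtain y where y: "desc \<rho> x y" "hit e y" using can_win_hit[OF x(1) assms(2)[OF x]] .
  have "strict_prefix q y" using x(2) desc_prefix[OF y(1)] by (meson prefix_order.less_le_trans)
  then show ?thesis using response_hit y(2) by blast
qed

text \<open>Mazur may open anywhere, so a win must stay within reach below every node; then each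
  answer of Banach is a hit.\<close>

lemma banach_winsI:
  assumes "\<And>v. node v \<Longrightarrow> can_win True \<rho> v"
  shows "banach_wins branches (parity_objective G \<chi>)"
  unfolding banach_wins_def
proof (intro exI conjI allI impI)
  let ?f = "\<lambda>ws. response True (last ws)"
  show "banach_strategy branches ?f"
    unfolding banach_strategy_def using response_position by fastforce
  fix p assume p: "bm_play branches p \<and> (\<forall>n. odd n \<longrightarrow> p n = ?f (map p [0..<n]))"
  have "hit True (p (2 * n + 1))" for n
  proof -
    have "p (2 * n + 1) = response True (p (2 * n))" using p by simp
    then show ?thesis using response_hit_can_win play_limit(2) p assms by simp
  qed
  then have "\<exists>k\<ge>n. hit True (p k)" for n by (intro exI[of _ "2 * n + 1"]) auto
  then show "bm_limit p \<in> parity_objective G \<chi>" using hits_parity p by blast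
qed

text \<open>One reachable settled history is enough: Mazur opens with a hit \<open>x0\<close>, and
  all nodes extending it are settled as well.\<close>

lemma mazur_winsI:
  assumes "can_win False \<rho> [Inl s0]"
  shows "mazur_wins branches (parity_objective G \<chi>)"
proof -
  obtain x0 where x0: "hit False x0" using can_win_hit[OF _ assms] by blast
  then have nx0: "node x0" unfolding hit_def by blast
  let ?f = "\<lambda>ws. if ws = [] then x0 else response False (last ws)"
  have "mazur_strategy branches ?f"
    unfolding mazur_strategy_def
    using response_position node_in_prefixes[OF nx0] by (auto simp: bm_position_def)
  moreover have "bm_limit p \<notin> parity_objective G \<chi>"
    if p: "bm_play branches p" "\<forall>n. even n \<longrightarrow> p n = ?f (map p [0..<n])" for p
  proof -
    note lim = play_limit[OF p(1)]
    have p0: "p 0 = x0" using p(2) by auto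
    have "hit False (p (2 * n + 2))" for n
    proof -
      have "p (2 * n + 2) = response False (p (2 * n + 1))" using p(2) by simp
      moreover have "hit False (response False (p (2 * n + 1)))"
      proof (rule response_hit_can_win[OF lim(2)])
        fix x assume x: "node x" "strict_prefix (p (2 * n + 1)) x"
        have "prefix x0 (p (2 * n + 1))" using strict_chain_prefix[of p 0, OF lim(1)] p0 by simp
        then have "desc \<rho> x0 x"
          using prefix_node_desc[OF x(1) nx0] x(2) by (meson prefix_order.less_imp_le prefix_order.trans)
        then show "can_win False \<rho> x"
          using x0 settled_desc unfolding hit_def can_win_def by (metis rtranclp.rtrancl_refl)
      qed
      ultimately show ?thesis by simp
    qed
    then have "\<exists>k\<ge>n. hit False (p k)" for n by (intro exI[of _ "2 * n + 2"]) auto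
    then show ?thesis using hits_parity p(1) by blast
  qed
  ultimately show ?thesis unfolding mazur_wins_def by blast
qed

end

section \<open>From pairs of strategies to merged choices, and determinacy\<close>

context priority_game
begin

definition joint :: "(('s + 'a) list \<Rightarrow> 'a) \<Rightarrow> (('s + 'a) list \<Rightarrow> 'a) \<Rightarrow> ('s + 'a) list \<Rightarrow> 'a" where
  "joint \<sigma> \<tau> h = (if label h \<in> eve G then \<sigma> h else \<tau> h)"

lemma history_simps:
  "[Inl t] \<in> histories G T \<longleftrightarrow> t \<in> T"
  "h \<in> histories G T \<Longrightarrow> last h = Inl (label h) \<and> label h \<in> T"
proof -
  have "[Inl t] \<in> histories G T" if "t \<in> T"
    unfolding histories_def using that by (intro CollectI exI[of _ "[]"] exI[of _ t]) simp
  then show "[Inl t] \<in> histories G T \<longleftrightarrow> t \<in> T" by (auto simp: histories_def)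
qed (auto simp: histories_def)

lemma history_step:
  assumes "h \<in> histories G T" "T \<subseteq> states G" "a \<in> actions G" "t \<in> T'"
  shows "h @ [Inr a, Inl t] \<in> histories G T'"
proof -
  obtain ps r where h: "h = concat (map (\<lambda>(s, a). [Inl s, Inr a]) ps) @ [Inl r]"
    "set ps \<subseteq> states G \<times> actions G" "r \<in> T" using assms(1) unfolding histories_def by blast
  show ?thesis unfolding histories_def
    by (rule CollectI, rule exI[of _ "ps @ [(r, a)]"], rule exI[of _ t]) (use h assms in auto)
qed

lemma history_label:
  assumes "h \<in> histories G (states G)" "label h \<in> T"
  shows "h \<in> histories G T"
  using assms unfolding histories_def by auto

lemma joint_legal:
  assumes \<sigma>: "\<sigma> \<in> strategies G (eve G)" and \<tau>: "\<tau> \<in> strategies G (adam G)"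
    and h: "h \<in> histories G (states G)"
  shows "joint \<sigma> \<tau> h \<in> actions G"
proof -
  have "label h \<in> eve G \<or> label h \<in> adam G"
    using history_simps(2)[OF h] game unfolding bm_game_def by blast
  then show ?thesis using \<sigma> \<tau> history_label[OF h] unfolding joint_def strategies_def by auto
qed

lemma desc_history:
  assumes "\<sigma> \<in> strategies G (eve G)" "\<tau> \<in> strategies G (adam G)" "s \<in> states G"
    "desc (joint \<sigma> \<tau>) [Inl s] v"
  shows "v \<in> histories G (states G)"
  using assms(4)
proof (induction rule: rtranclp_induct)
  case base
  then show ?case using assms(3) history_simps(1) by blast
next
  case (step v w)
  then obtain t where w: "w = v @ [Inr (joint \<sigma> \<tau> v), Inl t]" "(label v, joint \<sigma> \<tau> v, t) \<in> trans_rel G"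
    unfolding step_def by blast
  have "t \<in> states G" using w(2) game unfolding bm_game_def by blast
  then show ?case using history_step[OF step.IH] joint_legal[OF assms(1,2) step.IH] w(1) by blast
qed

lemma joint_play_tree:
  assumes "\<sigma> \<in> strategies G (eve G)" "\<tau> \<in> strategies G (adam G)" "s \<in> states G"
  shows "play_tree G (joint \<sigma> \<tau>) s"
proof unfold_locales
  fix v assume "desc (joint \<sigma> \<tau>) [Inl s] v"
  then have "v \<in> histories G (states G)" using desc_history assms by blast
  then show "label v \<in> states G \<and> joint \<sigma> \<tau> v \<in> actions G"
    using history_simps(2) joint_legal assms by blast
qed

lemma finite_tree_desc: "v \<in> finite_tree G \<sigma> \<tau> s \<longleftrightarrow> desc (joint \<sigma> \<tau>) [Inl s] v"
proof
  assume "v \<in> finite_tree G \<sigma> \<tau> s"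
  then show "desc (joint \<sigma> \<tau>) [Inl s] v"
  proof induction
    case (step w t a t')
    have "step (joint \<sigma> \<tau>) (w @ [Inl t]) (w @ [Inl t, Inr a, Inl t'])"
      unfolding step_def joint_def using step.hyps by auto
    then show ?case using step.IH by (meson rtranclp.rtrancl_into_rtrancl)
  qed simp
next
  assume "desc (joint \<sigma> \<tau>) [Inl s] v"
  \<comment> \<open>Strengthened by the shape of \<open>v\<close>, as the rule
    \<open>finite_tree.step\<close> applies only to words with a last state split off.\<close>
  then have "v \<in> finite_tree G \<sigma> \<tau> s \<and> (\<exists>w t. v = w @ [Inl t])"
  proof (induction rule: rtranclp_induct)
    case base
    then show ?case using finite_tree.root by auto
  next
    case (step v x)
    then obtain w r where v: "v = w @ [Inl r]" by blast
    obtain t where x: "x = v @ [Inr (joint \<sigma> \<tau> v), Inl t]" "(label v, joint \<sigma> \<tau> v, t) \<in> trans_rel G"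
      using step.hyps(2) unfolding step_def by blast
    have "w @ [Inl r, Inr (joint \<sigma> \<tau> v), Inl t] \<in> finite_tree G \<sigma> \<tau> s"
      by (rule finite_tree.step) (use step.IH v x in \<open>auto simp: joint_def\<close>)
    then show ?case using x(1) v by auto
  qed
  then show "v \<in> finite_tree G \<sigma> \<tau> s" by blast
qed

lemma residual_tree_branches:
  assumes "play_tree G (joint \<sigma> \<tau>) s"
  shows "residual_tree G \<sigma> \<tau> s = play_tree.branches G (joint \<sigma> \<tau>) s"
  unfolding residual_tree_def play_tree.branches_def[OF assms] finite_tree_desc by simp

text \<open>A strategy needs a legal value also outside the set \<open>D\<close> on which
  \<open>f\<close> prescribes the choices; a fixed action keeps it positional.\<close>

definition positional_strategy :: "'s set \<Rightarrow> ('s \<Rightarrow> 'a) \<Rightarrow> ('s + 'a) list \<Rightarrow> 'a" where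
  "positional_strategy D f h = (if label h \<in> D then f (label h) else (SOME a. a \<in> actions G))"

lemma positional_strategy:
  assumes "\<And>s. s \<in> D \<inter> T \<Longrightarrow> f s \<in> actions G"
  shows "positional_strategy D f \<in> strategies G T" "positional G T (positional_strategy D f)"
proof -
  have "(SOME a. a \<in> actions G) \<in> actions G"
    using game some_in_eq unfolding bm_game_def by blast
  then show "positional_strategy D f \<in> strategies G T"
    using assms history_simps(2) unfolding strategies_def positional_strategy_def by auto
  show "positional G T (positional_strategy D f)"
    unfolding positional_def positional_strategy_def label_def by auto
qed

lemma joint_conform:
  assumes \<sigma>: "\<sigma> \<in> strategies G (eve G)" and \<tau>: "\<tau> \<in> strategies G (adam G)" and s: "s \<in> states G"
    and f: "(if e then \<sigma> else \<tau>) = positional_strategy D f"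
  shows "conform e (states G) D f (joint \<sigma> \<tau>) [Inl s]"
  unfolding conform_def
proof (intro allI impI)
  fix v assume "desc (joint \<sigma> \<tau>) [Inl s] v"
  then have v: "v \<in> histories G (states G)" using desc_history \<sigma> \<tau> s by blast
  have "joint \<sigma> \<tau> v = (if e then \<sigma> else \<tau>) v" if "label v \<in> own e"
    using that game unfolding own_def joint_def bm_game_def by (auto split: if_splits)
  then show "label v \<in> states G \<and> joint \<sigma> \<tau> v \<in> actions G \<and>
      (label v \<in> own e \<inter> D \<longrightarrow> joint \<sigma> \<tau> v = f (label v))"
    using history_simps(2)[OF v] joint_legal[OF \<sigma> \<tau> v] f by (auto simp: positional_strategy_def)
qed

lemma determined:
  assumes s: "s \<in> states G"
  shows "(\<exists>\<sigma>\<in>strategies G (eve G). positional G (eve G) \<sigma> \<and> eve_banach_win_with G \<chi> s \<sigma>) \<or>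
    (\<exists>\<tau>\<in>strategies G (adam G). positional G (adam G) \<tau> \<and> adam_mazur_win_with G \<chi> s \<tau>)"
proof -
  have "arena (states G)"
    using game enabled_states unfolding arena_def bm_game_def by auto
  \<comment> \<open>Peeling starts from the whole state set: nothing lies outside yet, the
    conditions on \<open>g\<close> are vacuous, and \<open>undefined\<close> serves.\<close>
  then obtain Y f g where Y: "closed True (states G) Y" "wins True Y f" "\<forall>s\<in>states G - Y. g s \<in> actions G"
    "\<forall>\<rho> u. conform False (states G) (states G - Y) g \<rho> u \<longrightarrow> label u \<notin> Y \<longrightarrow> can_win False \<rho> u"
    using winning_partition[of "states G" undefined] conform_label closed_refl by blast
  show ?thesis
  proof (cases "s \<in> Y")
    case True
    let ?\<sigma> = "positional_strategy Y f"
    have f: "f r \<in> enabled Y r" if "r \<in> Y \<inter> own True" for r using Y(2) that unfolding wins_def by blast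
    then have \<sigma>: "?\<sigma> \<in> strategies G (eve G)" "positional G (eve G) ?\<sigma>"
      by (auto intro!: positional_strategy simp: own_def enabled_def)
    have "eve_banach_win_with G \<chi> s ?\<sigma>"
      unfolding eve_banach_win_with_def
    proof
      fix \<tau> assume \<tau>: "\<tau> \<in> strategies G (adam G)"
      let ?\<rho> = "joint ?\<sigma> \<tau>"
      interpret play_tree G \<chi> ?\<rho> s using joint_play_tree[OF \<sigma>(1) \<tau> s] .
      have c: "conform True (states G) Y f ?\<rho> [Inl s]" by (rule joint_conform[OF \<sigma>(1) \<tau> s]) simp
      \<comment> \<open>Adam cannot leave \<open>Y\<close> and Eve's choices stay in it, so a win
        stays within reach at every node, as Banach needs.\<close>
      have c: "conform True Y Y f ?\<rho> [Inl s]"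
        by (rule conform_closed[OF c _ Y(1)]) (use f True in auto)
      have "can_win True ?\<rho> v" if "node v" for v
        using conform_desc[OF c that] Y(2) unfolding wins_def by blast
      then show "banach_wins (residual_tree G ?\<sigma> \<tau> s) (parity_objective G \<chi>)"
        using banach_winsI residual_tree_branches[OF joint_play_tree[OF \<sigma>(1) \<tau> s]] by simp
    qed
    then show ?thesis using \<sigma> by blast
  next
    case False
    let ?\<tau> = "positional_strategy (states G - Y) g"
    have \<tau>: "?\<tau> \<in> strategies G (adam G)" "positional G (adam G) ?\<tau>"
      using Y(3) by (auto intro!: positional_strategy)
    have "adam_mazur_win_with G \<chi> s ?\<tau>"
      unfolding adam_mazur_win_with_def
    proof
      fix \<sigma> assume \<sigma>: "\<sigma> \<in> strategies G (eve G)"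
      let ?\<rho> = "joint \<sigma> ?\<tau>"
      interpret play_tree G \<chi> ?\<rho> s using joint_play_tree[OF \<sigma> \<tau>(1) s] .
      have c: "conform False (states G) (states G - Y) g ?\<rho> [Inl s]"
        by (rule joint_conform[OF \<sigma> \<tau>(1) s]) simp
      then have "can_win False ?\<rho> [Inl s]" using Y(4) False by simp
      then show "mazur_wins (residual_tree G \<sigma> ?\<tau> s) (parity_objective G \<chi>)"
        using mazur_winsI residual_tree_branches[OF joint_play_tree[OF \<sigma> \<tau>(1) s]] by simp
    qed
    then show ?thesis using \<tau> by blast
  qed
qed

end

theorem theorem15:
  fixes G :: "('s, 'a) game" and \<chi> :: "'s \<Rightarrow> nat"
  assumes "bm_game G"
  shows "\<forall>s\<in>states G.
    (\<exists>\<sigma>\<in>strategies G (eve G). positional G (eve G) \<sigma> \<and> eve_banach_win_with G \<chi> s \<sigma>) \<or>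
    (\<exists>\<tau>\<in>strategies G (adam G). positional G (adam G) \<tau> \<and> adam_mazur_win_with G \<chi> s \<tau>)"
proof -
  interpret priority_game G \<chi> using assms by unfold_locales
  show ?thesis using determined by blast
qed

end
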